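(* Let $m,S\ge 1$ be integers, let $p_1,\dots,p_S:\mathbb{R}^m\to(0,\infty)$ be differentiable log-concave functions, and let $F:\mathbb{R}^m\to\mathbb{R}$ be given by $F(\theta)=-\log\left(\sum_{s=1}^S p_s(\theta)\right)$. For $\theta\in\mathbb{R}^m$ write $\pi(\theta)=\left[\frac{p_s(\theta)}{\sum_{s'=1}^S p_{s'}(\theta)}\right]_{1\le s\le S}\in\Delta_S$. (i) For all $\theta,\eta\in\mathbb{R}^m$, $$F(\eta)-F(\theta)\ge\nabla^{\eta}F(\theta)^\top(\eta-\theta)+D_{\mathrm{KL}}\left(\pi(\eta)\,\|\,\pi(\theta)\right).$$ (ii) More generally, for any $\mu\in\Delta_S$ and all $\theta,\eta\in\mathbb{R}^m$, $$F(\eta)-F(\theta)\ge\nabla^{\mu}F(\theta)^\top(\eta-\theta)+D_{\mathrm{KL}}\left(\mu\,\|\,\pi(\theta)\right)-D_{\mathrm{KL}}\left(\mu\,\|\,\pi(\eta)\right).$$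
   Context: $\Delta_S=\{\mu\in[0,1]^S:\mu_1+\dots+\mu_S=1\}$ is the probability simplex. A function $p:\mathbb{R}^m\to(0,\infty)$ is log-concave if $\log p$ is concave. The Kullback-Leibler divergence of $\mu,\nu\in\Delta_S$ is $D_{\mathrm{KL}}(\mu\|\nu)=\sum_{s=1}^S\mu_s\log(\mu_s/\nu_s)$, with the usual convention $0\log 0=0$. Given the representation $F=-\log(\sum_{s=1}^S p_s)$, the cross-gradients of $F$ at $\theta\in\mathbb{R}^m$ are defined, for $\mu\in\Delta_S$ and for $\eta\in\mathbb{R}^m$ respectively, by $$\nabla^{\mu}F(\theta)=-\sum_{s=1}^S\mu_s\frac{\nabla p_s(\theta)}{p_s(\theta)},\qquad \nabla^{\eta}F(\theta)=-\sum_{s=1}^S\frac{p_s(\eta)}{\sum_{s'=1}^S p_{s'}(\eta)}\frac{\nabla p_s(\theta)}{p_s(\theta)}.$$ *)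

theory Defs
  imports "HOL-Analysis.Analysis"
begin

text \<open>
  A family \<open>p\<^sub>1, \<dots>, p\<^sub>S\<close> is indexed by a finite type \<open>'s\<close>, so that \<open>S = CARD('s)\<close>, and
  \<open>m = CARD('m)\<close>; both are at least \<open>1\<close> because types are nonempty.
\<close>

definition gradient :: "('a::real_inner \<Rightarrow> real) \<Rightarrow> 'a \<Rightarrow> 'a"
  where "gradient f x = (THE D. GDERIV f x :> D)"

text \<open>To be used only together with positivity of \<open>f\<close>, as \<open>ln\<close> is total.\<close>

definition log_concave :: "('a::real_vector \<Rightarrow> real) \<Rightarrow> bool"
  where "log_concave f \<longleftrightarrow> concave_on UNIV (\<lambda>x. ln (f x))"

definition prob_simplex :: "(real ^ 's) set"
  where "prob_simplex = {\<mu>. (\<forall>s. \<mu> $ s \<in> {0..1}) \<and> (\<Sum>s\<in>UNIV. \<mu> $ s) = 1}"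

text \<open>
  The convention \<open>0 log 0 = 0\<close> needs no case distinction: the factor \<open>\<mu> $ s = 0\<close> already makes
  the summand vanish. The definition is meaningful only where \<open>\<nu> $ s = 0\<close> implies \<open>\<mu> $ s = 0\<close>
  (the divergence is otherwise infinite); below, \<open>\<nu>\<close> always has positive entries.
\<close>

definition KL_div :: "real ^ 's \<Rightarrow> real ^ 's \<Rightarrow> real"
  where "KL_div \<mu> \<nu> = (\<Sum>s\<in>UNIV. \<mu> $ s * ln (\<mu> $ s / \<nu> $ s))"

definition neg_log_sum :: "('s::finite \<Rightarrow> 'a \<Rightarrow> real) \<Rightarrow> 'a \<Rightarrow> real"
  where "neg_log_sum p \<theta> = - ln (\<Sum>s\<in>UNIV. p s \<theta>)"

definition weights :: "('s::finite \<Rightarrow> 'a \<Rightarrow> real) \<Rightarrow> 'a \<Rightarrow> real ^ 's"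
  where "weights p \<theta> = (\<chi> s. p s \<theta> / (\<Sum>s'\<in>UNIV. p s' \<theta>))"

text \<open>
  The cross-gradients \<open>\<nabla>\<^sup>\<mu>F(\<theta>)\<close> and \<open>\<nabla>\<^sup>\<eta>F(\<theta>)\<close> depend on the representation of
  \<open>F = neg_log_sum p\<close> by \<open>p\<close>, not only on \<open>F\<close>.
\<close>

definition cross_gradient_simplex ::
    "('s::finite \<Rightarrow> 'a::real_inner \<Rightarrow> real) \<Rightarrow> real ^ 's \<Rightarrow> 'a \<Rightarrow> 'a"
  where "cross_gradient_simplex p \<mu> \<theta> =
    - (\<Sum>s\<in>UNIV. (\<mu> $ s) *\<^sub>R (gradient (p s) \<theta> /\<^sub>R p s \<theta>))"

definition cross_gradient_point ::
    "('s::finite \<Rightarrow> 'a::real_inner \<Rightarrow> real) \<Rightarrow> 'a \<Rightarrow> 'a \<Rightarrow> 'a"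
  where "cross_gradient_point p \<eta> \<theta> =
    - (\<Sum>s\<in>UNIV. (p s \<eta> / (\<Sum>s'\<in>UNIV. p s' \<eta>)) *\<^sub>R (gradient (p s) \<theta> /\<^sub>R p s \<theta>))"

lemma gradient_eq:
  assumes "GDERIV f x :> D"
  shows "gradient f x = D"
  unfolding gradient_def
proof (rule the_equality[of "\<lambda>D. GDERIV f x :> D", OF assms])
  fix D' assume "GDERIV f x :> D'"
  with assms have "(\<lambda>h. inner h D') = (\<lambda>h. inner h D)"
    unfolding gderiv_def by (blast intro: has_derivative_unique)
  then have "inner (D' - D) D' = inner (D' - D) D"
    by meson
  then show "D' = D"
    by (metis inner_diff_right inner_eq_zero_iff right_minus_eq)
qed

lemma GDERIV_gradient:
  fixes f :: "'a::euclidean_space \<Rightarrow> real"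
  assumes "f differentiable (at x)"
  shows "GDERIV f x :> gradient f x"
proof -
  obtain f' where f': "(f has_derivative f') (at x)"
    using assms by (auto simp: differentiable_def)
  interpret linear f'
    using f' by (rule has_derivative_linear)
  have "f' = (\<lambda>h. inner h (\<Sum>b\<in>Basis. f' b *\<^sub>R b))"
  proof
    fix h
    have "f' h = f' (\<Sum>b\<in>Basis. inner h b *\<^sub>R b)"
      by (simp add: euclidean_representation)
    also have "\<dots> = (\<Sum>b\<in>Basis. inner h b * f' b)"
      by (simp add: sum scale)
    also have "\<dots> = inner h (\<Sum>b\<in>Basis. f' b *\<^sub>R b)"
      by (simp add: inner_sum_right mult.commute)
    finally show "f' h = inner h (\<Sum>b\<in>Basis. f' b *\<^sub>R b)" .
  qed
  with f' have "GDERIV f x :> (\<Sum>b\<in>Basis. f' b *\<^sub>R b)"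
    unfolding gderiv_def by metis
  with gradient_eq show ?thesis
    by metis
qed

lemma weights_in_prob_simplex:
  fixes p :: "'s::finite \<Rightarrow> 'a \<Rightarrow> real"
  assumes "\<And>s. 0 < p s \<theta>"
  shows "weights p \<theta> \<in> prob_simplex"
proof -
  have pos: "0 < (\<Sum>s\<in>UNIV. p s \<theta>)"
    using assms by (intro sum_pos) auto
  moreover have "p s \<theta> \<le> (\<Sum>s\<in>UNIV. p s \<theta>)" for s
    using assms by (intro member_le_sum) (auto intro: less_imp_le)
  ultimately show ?thesis
    using assms by (auto simp: prob_simplex_def weights_def less_imp_le
        sum_divide_distrib[symmetric])
qed

end

theory Submission
  imports Defs
begin

text \<open>
  The entropy of \<open>\<mu>\<close> cancels in the difference of \<open>KL_div \<mu> (weights p \<theta>)\<close> and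
  \<open>KL_div \<mu> (weights p \<eta>)\<close>, which is therefore the change of \<open>neg_log_sum p\<close> plus the
  \<open>\<mu>\<close>-average of the changes of \<open>ln (p s)\<close>. Each \<open>ln (p s)\<close> lies
  below its linearisation at \<open>\<theta>\<close> by concavity. The first inequality is the case
  \<open>\<mu> = weights p \<eta>\<close> of the second.
\<close>

text \<open>Along the line through \<open>x\<close> and \<open>y\<close> the claim becomes the
  one-variable fact that a convex function lies above its tangent, applied to
  \<open>- f\<close>.\<close>

lemma concave_on_below_tangent:
  fixes f :: "'a::real_inner \<Rightarrow> real"
  assumes conc: "concave_on UNIV f" and deriv: "GDERIV f x :> D"
  shows "f y - f x \<le> D \<bullet> (y - x)"
proof -
  \<comment> \<open>The parametrisation has \<open>l 0 = x\<close> and \<open>l 1 = y\<close>. It is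
    affine, so composing with it preserves convexity.\<close>
  define l where "l = (\<lambda>t::real. x + t *\<^sub>R (y - x))"
  have l_conv: "l ((1 - t) *\<^sub>R a + t *\<^sub>R b) = (1 - t) *\<^sub>R l a + t *\<^sub>R l b" for t a b
    by (simp add: l_def algebra_simps)
  have conv: "convex_on UNIV (\<lambda>t. - f (l t))"
  proof (rule convex_onI)
    fix t a b :: real
    assume "0 < t" "t < 1"
    then show "- f (l ((1 - t) *\<^sub>R a + t *\<^sub>R b)) \<le> (1 - t) * - f (l a) + t * - f (l b)"
      using convex_onD[of UNIV "\<lambda>z. - f z" t "l a" "l b"] conc
      unfolding l_conv concave_on_def by simp
  qed simp
  have "(l has_derivative (\<lambda>h. h *\<^sub>R (y - x))) (at 0)"
    unfolding l_def by (auto intro!: derivative_eq_intros)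
  moreover have "(f has_derivative (\<lambda>h. h \<bullet> D)) (at (l 0))"
    using deriv by (simp add: gderiv_def l_def)
  ultimately have "((\<lambda>t. f (l t)) has_derivative (\<lambda>h. (h *\<^sub>R (y - x)) \<bullet> D)) (at 0)"
    by (rule has_derivative_compose)
  then have "((\<lambda>t. - f (l t)) has_derivative (\<lambda>h. - ((h *\<^sub>R (y - x)) \<bullet> D))) (at 0)"
    by (rule has_derivative_minus)
  moreover have "(\<lambda>h::real. - ((h *\<^sub>R (y - x)) \<bullet> D)) = (*) (- ((y - x) \<bullet> D))"
    by (auto simp: mult.commute)
  ultimately have "((\<lambda>t. - f (l t)) has_field_derivative - ((y - x) \<bullet> D)) (at 0)"
    by (simp add: has_field_derivative_def)
  \<comment> \<open>The tangent at parameter 0 is evaluated at 1, where the increment of the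
    parameter is 1 and only the slope remains.\<close>
  from convex_on_imp_above_tangent[OF conv _ _ _ this, of 1]
  show ?thesis
    by (simp add: l_def inner_commute)
qed

text \<open>By the chain rule \<open>gradient f x /\<^sub>R f x\<close> is the gradient of
  \<open>ln f\<close> at \<open>x\<close>, so this is the tangent bound for the concave function
  \<open>ln f\<close>.\<close>

lemma log_concave_ln_diff_le:
  fixes f :: "'a::euclidean_space \<Rightarrow> real"
  assumes "log_concave f" "f differentiable (at x)" "0 < f x"
  shows "ln (f y) - ln (f x) \<le> (gradient f x /\<^sub>R f x) \<bullet> (y - x)"
proof (rule concave_on_below_tangent)
  show "concave_on UNIV (\<lambda>x. ln (f x))"
    using assms(1) by (simp add: log_concave_def)
  have "(f has_derivative (\<lambda>h. h \<bullet> gradient f x)) (at x)"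
    using GDERIV_gradient[OF assms(2)] by (simp add: gderiv_def)
  then show "GDERIV (\<lambda>x. ln (f x)) x :> gradient f x /\<^sub>R f x"
    unfolding gderiv_def using assms(3)
    by (auto intro!: derivative_eq_intros simp: divide_inverse mult.commute)
qed

text \<open>In each summand either the factor \<open>\<mu> $ s\<close> is 0 or the ratio is
  1.\<close>

lemma KL_div_self: "KL_div \<mu> \<mu> = 0"
  unfolding KL_div_def by (intro sum.neutral) auto

lemma KL_div_weights_diff:
  fixes p :: "'s::finite \<Rightarrow> 'a \<Rightarrow> real"
  assumes pos: "\<And>s \<theta>. 0 < p s \<theta>" and \<mu>: "\<mu> \<in> prob_simplex"
  shows "KL_div \<mu> (weights p \<theta>) - KL_div \<mu> (weights p \<eta>) =
    neg_log_sum p \<eta> - neg_log_sum p \<theta> + (\<Sum>s\<in>UNIV. \<mu> $ s * (ln (p s \<eta>) - ln (p s \<theta>)))"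
proof -
  have Z: "0 < (\<Sum>s\<in>UNIV. p s z)" for z
    using pos by (intro sum_pos) auto
  \<comment> \<open>Splitting the logarithm of the quotient requires \<open>\<mu> $ s > 0\<close>;
    at a zero entry the factor \<open>\<mu> $ s\<close> makes both sides vanish. The normalising sum
    contributes \<open>- neg_log_sum p z\<close>, the same for every \<open>s\<close>.\<close>
  have ln_ratio: "\<mu> $ s * ln (\<mu> $ s / weights p z $ s) =
      \<mu> $ s * (ln (\<mu> $ s) - ln (p s z) - neg_log_sum p z)" for s z
  proof (cases "\<mu> $ s = 0")
    case False
    then have "0 < \<mu> $ s"
      using \<mu> by (auto simp: prob_simplex_def order_less_le)
    then show ?thesis
      using pos[of s z] Z[of z] by (simp add: weights_def neg_log_sum_def ln_div ln_mult_pos)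
  qed simp
  have "KL_div \<mu> (weights p \<theta>) - KL_div \<mu> (weights p \<eta>) =
      (\<Sum>s\<in>UNIV. \<mu> $ s * (neg_log_sum p \<eta> - neg_log_sum p \<theta>))
      + (\<Sum>s\<in>UNIV. \<mu> $ s * (ln (p s \<eta>) - ln (p s \<theta>)))"
    unfolding KL_div_def ln_ratio sum_subtractf[symmetric] sum.distrib[symmetric]
    by (intro sum.cong) (auto simp: algebra_simps)
  \<comment> \<open>The entries of \<open>\<mu>\<close> sum to 1, so averaging the constant change
    of \<open>neg_log_sum p\<close> returns it unchanged.\<close>
  then show ?thesis
    using \<mu> by (simp add: sum_distrib_right[symmetric] prob_simplex_def)
qed

lemma cross_gradient_point_eq:
  "cross_gradient_point p \<eta> \<theta> = cross_gradient_simplex p (weights p \<eta>) \<theta>"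
  by (simp add: cross_gradient_point_def cross_gradient_simplex_def weights_def)

lemma cross_gradient_simplex_bound:
  fixes p :: "'s::finite \<Rightarrow> 'a::euclidean_space \<Rightarrow> real"
  assumes pos: "\<And>s \<theta>. 0 < p s \<theta>"
    and diff: "\<And>s. p s differentiable (at \<theta>)"
    and lc: "\<And>s. log_concave (p s)"
    and \<mu>: "\<mu> \<in> prob_simplex"
  shows "cross_gradient_simplex p \<mu> \<theta> \<bullet> (\<eta> - \<theta>)
      + KL_div \<mu> (weights p \<theta>) - KL_div \<mu> (weights p \<eta>)
    \<le> neg_log_sum p \<eta> - neg_log_sum p \<theta>"
proof -
  have "(\<Sum>s\<in>UNIV. \<mu> $ s * (ln (p s \<eta>) - ln (p s \<theta>))) \<le>
      (\<Sum>s\<in>UNIV. \<mu> $ s * ((gradient (p s) \<theta> /\<^sub>R p s \<theta>) \<bullet> (\<eta> - \<theta>)))"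
    using \<mu> by (intro sum_mono mult_left_mono log_concave_ln_diff_le lc diff pos)
      (auto simp: prob_simplex_def)
  \<comment> \<open>The minus sign in the cross-gradient turns the upper bound on the logarithms
    into a lower bound on the change of \<open>neg_log_sum p\<close>.\<close>
  also have "\<dots> = - (cross_gradient_simplex p \<mu> \<theta> \<bullet> (\<eta> - \<theta>))"
    by (simp add: cross_gradient_simplex_def inner_sum_left mult.assoc)
  finally show ?thesis
    using KL_div_weights_diff[of p \<mu> \<theta> \<eta>, OF pos \<mu>] by linarith
qed

theorem lemma1:
  fixes p :: "'s::finite \<Rightarrow> real ^ 'm \<Rightarrow> real"
    and F :: "real ^ 'm \<Rightarrow> real"
    and \<pi> :: "real ^ 'm \<Rightarrow> real ^ 's"
  assumes pos: "\<And>s \<theta>. 0 < p s \<theta>"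
    and diff: "\<And>s \<theta>. p s differentiable (at \<theta>)"
    and lc: "\<And>s. log_concave (p s)"
    and F: "F = neg_log_sum p"
    and weights: "\<pi> = weights p"
  shows "(\<forall>\<theta> \<eta>. F \<eta> - F \<theta> \<ge>
            cross_gradient_point p \<eta> \<theta> \<bullet> (\<eta> - \<theta>) + KL_div (\<pi> \<eta>) (\<pi> \<theta>)) \<and>
         (\<forall>\<mu>\<in>prob_simplex. \<forall>\<theta> \<eta>. F \<eta> - F \<theta> \<ge>
            cross_gradient_simplex p \<mu> \<theta> \<bullet> (\<eta> - \<theta>)
              + KL_div \<mu> (\<pi> \<theta>) - KL_div \<mu> (\<pi> \<eta>))"
proof (intro conjI allI ballI)
  fix \<theta> \<eta>
  have "weights p \<eta> \<in> prob_simplex"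
    by (rule weights_in_prob_simplex) (rule pos)
  \<comment> \<open>For \<open>\<mu> = weights p \<eta>\<close> the subtracted divergence compares
    \<open>\<mu>\<close> with itself and drops out.\<close>
  from cross_gradient_simplex_bound[of p \<theta> _ \<eta>, OF pos diff lc this]
  show "cross_gradient_point p \<eta> \<theta> \<bullet> (\<eta> - \<theta>) + KL_div (\<pi> \<eta>) (\<pi> \<theta>) \<le> F \<eta> - F \<theta>"
    by (simp add: F weights cross_gradient_point_eq KL_div_self)
next
  fix \<mu> :: "real ^ 's" and \<theta> \<eta>
  assume "\<mu> \<in> prob_simplex"
  from cross_gradient_simplex_bound[of p \<theta> _ \<eta>, OF pos diff lc this]
  show "cross_gradient_simplex p \<mu> \<theta> \<bullet> (\<eta> - \<theta>) + KL_div \<mu> (\<pi> \<theta>) - KL_div \<mu> (\<pi> \<eta>)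
      \<le> F \<eta> - F \<theta>"
    by (simp add: F weights)
qed

end
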